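(* There is no triangular family $\mathcal{Z}=\{z_{n,j}\}_{n\ge0,\,0\le j\le m_n}\subset\mathbb{T}$ with $m_n=n$ for all $n$ that is an M-Z family for $L^1$.
   Context: $\mathbb{T}$ is the unit circle in $\mathbb{C}$. $\mathcal{P}_n$ is the space of holomorphic polynomials (complex coefficients, one variable) of degree at most $n$. A triangular family is a collection $\mathcal{Z}=\{z_{n,j}\}$, $n\ge 0$, $0\le j\le m_n$, of points $z_{n,j}\in\mathbb{T}$. $\mathcal{Z}$ is an M-Z (Marcinkiewicz-Zygmund) family for $L^1$ if there is a constant $C_1>0$ such that for all $n\ge1$ and all $q\in\mathcal{P}_n$, $$\frac{C_1^{-1}}{m_n}\sum_{j=0}^{m_n}|q(z_{n,j})|\le\int_0^{2\pi}|q(e^{i\theta})|\,d\theta\le\frac{C_1}{m_n}\sum_{j=0}^{m_n}|q(z_{n,j})|.$$ *)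

theory Defs
  imports "HOL-Analysis.Analysis" "HOL-Computational_Algebra.Polynomial"
begin

definition polys_upto :: "nat \<Rightarrow> complex poly set" where
  "polys_upto n = {q. degree q \<le> n}"

(* Points are indexed by n and 0 <= j <= m n, with repetitions allowed; values z n j with j > m n
   are irrelevant. *)
definition triangular_family :: "(nat \<Rightarrow> nat) \<Rightarrow> (nat \<Rightarrow> nat \<Rightarrow> complex) \<Rightarrow> bool" where
  "triangular_family m z \<longleftrightarrow> (\<forall>n. \<forall>j\<le>m n. z n j \<in> sphere 0 1)"

definition MZ_family_L1 :: "(nat \<Rightarrow> nat) \<Rightarrow> (nat \<Rightarrow> nat \<Rightarrow> complex) \<Rightarrow> bool" where
  "MZ_family_L1 m z \<longleftrightarrow>
     triangular_family m z \<and>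
     (\<exists>C::real. C > 0 \<and>
       (\<forall>n\<ge>1. \<forall>q\<in>polys_upto n.
          inverse C / real (m n) * (\<Sum>j=0..m n. cmod (poly q (z n j)))
            \<le> integral {0..2 * pi} (\<lambda>\<theta>. cmod (poly q (cis \<theta>))) \<and>
          integral {0..2 * pi} (\<lambda>\<theta>. cmod (poly q (cis \<theta>)))
            \<le> C / real (m n) * (\<Sum>j=0..m n. cmod (poly q (z n j)))))"

end

theory Submission
  imports Defs
begin

text \<open>The right-hand inequality forces the \<open>n + 1\<close> nodes to be distinct, so every
  function on them is interpolated by some \<open>q\<close> of degree at most \<open>n\<close>, and it bounds the \<open>L\<^sup>1\<close> norm of
  \<open>q\<close> by the \<open>\<ell>\<^sup>1\<close> norm of the data. Interpolate the rotated Fejer kernels, rotate the interpolants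
  back, and average over the rotations (finitely many suffice, since all frequencies are at most
  \<open>2n\<close>). The averaged interpolant is the analytic part \<open>\<Sum>k\<le>n. (1 - k / (n + 1)) w ^ k\<close> of the Fejer
  kernel, whatever the nodes are. As the Fejer kernel is nonnegative with mean one, the averaged data
  have \<open>\<ell>\<^sup>1\<close> norm \<open>n + 1\<close>, so the analytic part has \<open>L\<^sup>1\<close> norm bounded independently of \<open>n\<close>. Pairing
  it with the sawtooth \<open>\<pi> - t\<close> shows that this norm grows like \<open>log n\<close>.\<close>

section \<open>Sums over rotations\<close>

text \<open>A geometric sum in an \<open>L\<close>-th root of unity \<open>w\<close>. The bound on
  \<open>d\<close> ensures that \<open>w = 1\<close> only for \<open>d = 0\<close>, so summing over
  \<open>L\<close> equally spaced rotations isolates the zero frequency.\<close>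

lemma sum_cis_roots_of_unity:
  fixes d :: int and L :: nat
  assumes "\<bar>d\<bar> < int L"
  shows "(\<Sum>l<L. cis (2 * pi * real l * of_int d / real L)) = (if d = 0 then of_nat L else 0)"
proof (cases "d = 0")
  case False
  define w where "w = cis (2 * pi * of_int d / real L)"
  have L: "L > 0" using assms by linarith
  have pow: "cis (2 * pi * real l * of_int d / real L) = w ^ l" for l
    by (simp add: w_def Complex.DeMoivre mult_ac)
  have "w ^ L = cis (2 * pi * of_int d)"
    using L by (simp add: w_def Complex.DeMoivre)
  then have wL: "w ^ L = 1"
    by simp
  have "w \<noteq> 1"
  proof
    assume "w = 1"
    then have "cos (2 * pi * of_int d / real L) = 1"
      by (simp add: w_def complex_eq_iff)
    then obtain k :: int where "2 * pi * of_int d / real L = of_int k * 2 * pi"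
      by (auto simp: cos_one_2pi_int)
    then have "real_of_int d = real_of_int (k * int L)"
      using L by (simp add: field_simps)
    then have dk: "d = k * int L"
      by linarith
    then have "\<bar>k\<bar> * int L < 1 * int L"
      using assms by (simp add: abs_mult)
    then show False
      using dk False by (simp add: mult_less_cancel_right)
  qed
  then have "(\<Sum>l<L. w ^ l) = 0"
    using wL by (simp add: geometric_sum)
  then show ?thesis
    using False by (simp add: pow)
qed simp

text \<open>The rotation shifts the interval of integration to \<open>{-s..2*pi-s}\<close>;
  periodicity moves the piece over \<open>{-s..0}\<close> to \<open>{2*pi-s..2*pi}\<close>.\<close>

lemma integral_rotate_cis:
  fixes f :: "complex \<Rightarrow> real"
  assumes cont: "continuous_on UNIV f" and s: "0 \<le> s" "s \<le> 2 * pi"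
  shows "integral {0..2*pi} (\<lambda>t. f (cnj (cis s) * cis t)) = integral {0..2*pi} (\<lambda>t. f (cis t))"
proof -
  define h where "h t = f (cis t)" for t
  have ch: "continuous_on A h" for A
    unfolding h_def by (intro continuous_on_compose2[OF cont] continuous_intros) auto
  have per: "h (t + 2 * pi) = h t" for t
    by (simp add: h_def cis_mult[symmetric])
  have hi: "h integrable_on {a..b}" for a b
    by (rule integrable_continuous_real[OF ch])
  have shift: "integral {a..b} (\<lambda>t. h (t + c)) = integral {a+c..b+c} h" for a b c
    using integral_shift[where a = a and b = b and c = c and f = h] ch by (simp add: o_def)
  have "integral {0..2*pi} (\<lambda>t. f (cnj (cis s) * cis t)) = integral {0..2*pi} (\<lambda>t. h (t + (- s)))"
    by (simp add: h_def cis_cnj cis_mult algebra_simps)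
  also have "\<dots> = integral {-s..2*pi-s} h"
    using shift[of 0 "2*pi" "- s"] by simp
  also have "\<dots> = integral {-s..0} h + integral {0..2*pi-s} h"
    using Henstock_Kurzweil_Integration.integral_combine[where a = "-s" and c = 0 and b = "2*pi-s" and f = h] s hi by auto
  also have "integral {-s..0} h = integral {-s..0} (\<lambda>t. h (t + 2 * pi))"
    by (simp add: per)
  also have "\<dots> = integral {2*pi-s..2*pi} h"
    by (simp add: shift)
  also have "integral {2*pi-s..2*pi} h + integral {0..2*pi-s} h = integral {0..2*pi} h"
    using Henstock_Kurzweil_Integration.integral_combine[where a = 0 and c = "2*pi-s" and b = "2*pi" and f = h] s hi by auto
  finally show ?thesis
    unfolding h_def .
qed

section \<open>Interpolation\<close>

lemma poly_interpolation:
  fixes x :: "'b \<Rightarrow> 'a :: field"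
  assumes "finite A" "inj_on x A"
  obtains p where "degree p \<le> card A - 1" "\<And>j. j \<in> A \<Longrightarrow> poly p (x j) = f j"
proof
  \<comment> \<open>\<open>N j\<close> is the Lagrange basis polynomial of node \<open>j\<close>
    before normalisation.\<close>
  define N where "N j = (\<Prod>i\<in>A - {j}. [:- x i, 1:])" for j
  define p where "p = (\<Sum>j\<in>A. smult (f j / poly (N j) (x j)) (N j))"
  have N0: "poly (N j) (x j) \<noteq> 0" if "j \<in> A" for j
    using assms that by (auto simp: N_def poly_prod inj_on_def)
  have N1: "poly (N j) (x k) = 0" if "k \<in> A" "k \<noteq> j" for j k
    using assms that by (auto simp: N_def poly_prod)
  have "degree (N j) \<le> card A - 1" if "j \<in> A" for j
    using degree_prod_sum_le[of "A - {j}" "\<lambda>i. [:- x i, 1:]"] assms that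
    by (simp add: N_def o_def)
  then show "degree p \<le> card A - 1"
    unfolding p_def by (intro degree_sum_le) (use assms in \<open>auto intro: order_trans[OF degree_smult_le]\<close>)
  show "poly p (x j) = f j" if "j \<in> A" for j
  proof -
    have "poly p (x j) = (\<Sum>k\<in>A. if k = j then f j else 0)"
      unfolding p_def poly_sum using N0 N1 that by (intro sum.cong) auto
    then show ?thesis
      using that assms by simp
  qed
qed

lemma poly_eq_if_eq_at_nodes:
  fixes p q :: "'a :: idom poly"
  assumes "inj_on x A" "degree p < card A" "degree q < card A"
    "\<And>j. j \<in> A \<Longrightarrow> poly p (x j) = poly q (x j)"
  shows "p = q"
proof (rule ccontr)
  assume "p \<noteq> q"
  then have fin: "finite {y. poly (p - q) y = 0}"
    by (intro poly_roots_finite) simp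
  have "card A = card (x ` A)"
    using assms(1) by (simp add: card_image)
  also have "\<dots> \<le> card {y. poly (p - q) y = 0}"
    using assms(4) by (intro card_mono fin) auto
  also have "\<dots> \<le> degree (p - q)"
    using \<open>p \<noteq> q\<close> by (intro card_poly_roots_bound) simp
  also have "\<dots> < card A"
    using assms(2,3) degree_diff_le_max[of p q] by simp
  finally show False by simp
qed

lemma circle_integral_pos:
  fixes q :: "complex poly"
  assumes "q \<noteq> 0"
  shows "integral {0..2*pi} (\<lambda>t. cmod (poly q (cis t))) > 0"
proof -
  have cont: "continuous_on {0..2*pi} (\<lambda>t. cmod (poly q (cis t)))"
    by (intro continuous_intros)
  have "integral {0..2*pi} (\<lambda>t. cmod (poly q (cis t))) \<noteq> 0"
  proof
    assume "integral {0..2*pi} (\<lambda>t. cmod (poly q (cis t))) = 0"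
    then have "\<forall>t\<in>{0..2*pi}. cmod (poly q (cis t)) = 0"
      using integral_eq_0_iff[OF cont] by simp
    \<comment> \<open>The upper half circle suffices: there \<open>cos\<close> alone makes
      \<open>cis\<close> injective, so \<open>q\<close> would have infinitely many roots.\<close>
    then have "cis ` {0..pi} \<subseteq> {y. poly q y = 0}"
      by auto
    then have "finite (cis ` {0..pi})"
      using poly_roots_finite[OF assms] finite_subset by blast
    moreover have "inj_on cis {0..pi}"
      by (rule inj_onI) (auto simp: complex_eq_iff intro: cos_inj_pi)
    ultimately show False
      using finite_imageD infinite_Icc[OF pi_gt_zero] by blast
  qed
  moreover have "integral {0..2*pi} (\<lambda>t. cmod (poly q (cis t))) \<ge> 0"
    by (intro integral_nonneg integrable_continuous_real cont) simp
  ultimately show ?thesis by simp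
qed

text \<open>If nodes \<open>i\<close> and \<open>j\<close> coincide, the product of the linear
  factors of all nodes but \<open>i\<close> has degree \<open>n\<close> and still vanishes at every
  node, the factor of \<open>j\<close> taking care of \<open>i\<close>. Its positive integral then
  contradicts the bound.\<close>

lemma inj_on_nodes:
  fixes x :: "nat \<Rightarrow> complex"
  assumes "\<And>q. degree q \<le> n \<Longrightarrow>
    integral {0..2*pi} (\<lambda>t. cmod (poly q (cis t))) \<le> K * (\<Sum>j\<le>n. cmod (poly q (x j)))"
  shows "inj_on x {..n}"
proof (rule inj_onI, rule ccontr)
  fix i j assume ij: "i \<in> {..n}" "j \<in> {..n}" "x i = x j" "i \<noteq> j"
  define q where "q = (\<Prod>k\<in>{..n} - {i}. [:- x k, 1:])"
  have "degree q \<le> n"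
    using degree_prod_sum_le[of "{..n} - {i}" "\<lambda>k. [:- x k, 1:]"] ij by (simp add: q_def o_def)
  moreover have "poly q (x k) = 0" if "k \<le> n" for k
    using ij that by (auto simp: q_def poly_prod intro: bexI[of _ "if k = i then j else k"])
  ultimately have "integral {0..2*pi} (\<lambda>t. cmod (poly q (cis t))) \<le> 0"
    using assms[of q] by simp
  moreover have "q \<noteq> 0"
    by (simp add: q_def)
  ultimately show False
    using circle_integral_pos[of q] by simp
qed

section \<open>The analytic part of the Fejer kernel\<close>

definition fejer_analytic :: "nat \<Rightarrow> complex \<Rightarrow> complex" where
  "fejer_analytic n w = (\<Sum>k\<le>n. of_real (1 - real k / real (n + 1)) * w ^ k)"

lemma continuous_on_fejer_analytic [continuous_intros]:
  "continuous_on A f \<Longrightarrow> continuous_on A (\<lambda>t. fejer_analytic n (f t))"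
  unfolding fejer_analytic_def by (intro continuous_intros)

text \<open>On the circle, \<open>n + 1\<close> times the Fejer kernel is the double sum of
  \<open>w ^ r * cnj w ^ s\<close>. The terms with \<open>s \<le> r\<close> form its analytic part,
  and \<open>n + 1 - k\<close> pairs have difference \<open>k\<close>.\<close>

lemma fejer_analytic_double_sum:
  "of_nat (n + 1) * fejer_analytic n w = (\<Sum>r\<le>n. \<Sum>s\<le>n. if s \<le> r then w ^ (r - s) else 0)"
proof (induction n)
  case (Suc n)
  have F: "of_nat (n + 1) * fejer_analytic n w = (\<Sum>k\<le>n. of_nat (n + 1 - k) * w ^ k)" for n
    unfolding fejer_analytic_def sum_distrib_left
    by (intro sum.cong) (auto simp: of_nat_diff field_simps simp flip: of_nat_Suc)
  \<comment> \<open>Only the row \<open>r = Suc n\<close> is new: the column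
    \<open>s = Suc n\<close> satisfies \<open>s \<le> r\<close> in no other row.\<close>
  have "(\<Sum>r\<le>Suc n. \<Sum>s\<le>Suc n. if s \<le> r then w ^ (r - s) else 0)
      = (\<Sum>r\<le>n. \<Sum>s\<le>n. if s \<le> r then w ^ (r - s) else 0) + (\<Sum>s\<le>Suc n. w ^ (Suc n - s))"
    by simp
  also have "(\<Sum>s\<le>Suc n. w ^ (Suc n - s)) = (\<Sum>k\<le>Suc n. w ^ k)"
    using sum.nat_diff_reindex[of "\<lambda>k. w ^ k" "Suc (Suc n)"]
    by (simp only: lessThan_Suc_atMost diff_Suc_Suc)
  also have "(\<Sum>r\<le>n. \<Sum>s\<le>n. if s \<le> r then w ^ (r - s) else 0) = (\<Sum>k\<le>n. of_nat (n + 1 - k) * w ^ k)"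
    using Suc.IH F by simp
  also have "(\<Sum>k\<le>n. of_nat (n + 1 - k) * w ^ k) + (\<Sum>k\<le>Suc n. w ^ k)
      = (\<Sum>k\<le>Suc n. of_nat (Suc n + 1 - k) * w ^ k)"
    by (auto simp: sum.distrib[symmetric] Suc_diff_le algebra_simps intro!: sum.cong)
  finally show ?case
    by (simp only: F)
qed (simp add: fejer_analytic_def)

text \<open>The sine coefficients of the sawtooth decay only like \<open>1 / k\<close>, which is the
  source of the logarithmic growth. For \<open>k = 0\<close> both sides vanish, division by zero
  being zero.\<close>

lemma sawtooth_sine_integral:
  "((\<lambda>t. (pi - t) * sin (real k * t)) has_integral 2 * pi / real k) {0..2*pi}"
proof (cases "k = 0")
  case False
  \<comment> \<open>An antiderivative found by integration by parts; each endpoint contributes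
    \<open>pi / real k\<close>.\<close>
  define G where "G t = - ((pi - t) * cos (real k * t) / real k) - sin (real k * t) / (real k)\<^sup>2" for t
  have "((\<lambda>t. (pi - t) * sin (real k * t)) has_integral G (2*pi) - G 0) {0..2*pi}"
    by (intro fundamental_theorem_of_calculus)
      (use False in \<open>auto simp: G_def field_simps power2_eq_square
        simp flip: has_real_derivative_iff_has_vector_derivative intro!: derivative_eq_intros\<close>)
  moreover have "cos (real k * (2 * pi)) = 1" "sin (real k * (2 * pi)) = 0"
    using cos_int_2pin[of "int k"] sin_int_2pin[of "int k"] by (simp_all add: mult_ac)
  ultimately show ?thesis
    using False by (simp add: G_def)
qed simp

text \<open>Integrating the imaginary part against \<open>pi - t\<close>, which is at most
  \<open>pi\<close> in modulus, gives \<open>2 * pi * (harm n - n / (n + 1))\<close>.\<close>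

lemma fejer_analytic_L1_lower:
  "2 * (harm n - 1) \<le> integral {0..2*pi} (\<lambda>t. cmod (fejer_analytic n (cis t)))"
proof -
  have Im: "(pi - t) * Im (fejer_analytic n (cis t))
      = (\<Sum>k\<le>n. (1 - real k / real (n + 1)) * ((pi - t) * sin (real k * t)))" for t
    by (simp add: fejer_analytic_def Complex.DeMoivre sum_distrib_left mult_ac)
  have I: "((\<lambda>t. (pi - t) * Im (fejer_analytic n (cis t))) has_integral
      (\<Sum>k\<le>n. (1 - real k / real (n + 1)) * (2 * pi / real k))) {0..2*pi}"
    unfolding Im by (intro has_integral_sum has_integral_mult_right sawtooth_sine_integral) simp
  have "(\<Sum>k\<le>n. (1 - real k / real (n + 1)) * (2 * pi / real k))
      = (\<Sum>k=1..n. 2 * pi * (inverse (real k) - 1 / real (n + 1)))"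
    by (intro sum.mono_neutral_cong_right) (auto simp: field_simps Suc_le_eq)
  also have "\<dots> = 2 * pi * (harm n - real n / real (n + 1))"
    by (simp add: harm_def sum_distrib_left[symmetric] sum_subtractf)
  also have "\<dots> \<ge> 2 * pi * (harm n - 1)"
    by (intro mult_left_mono) auto
  finally have "2 * pi * (harm n - 1) \<le> (\<Sum>k\<le>n. (1 - real k / real (n + 1)) * (2 * pi / real k))" .
  also have "\<dots> \<le> integral {0..2*pi} (\<lambda>t. pi * cmod (fejer_analytic n (cis t)))"
  proof (rule has_integral_le[OF I])
    show "((\<lambda>t. pi * cmod (fejer_analytic n (cis t))) has_integral
        integral {0..2*pi} (\<lambda>t. pi * cmod (fejer_analytic n (cis t)))) {0..2*pi}"
      by (intro integrable_integral integrable_continuous_real continuous_intros)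
    fix t :: real assume "t \<in> {0..2*pi}"
    then have "\<bar>pi - t\<bar> * \<bar>Im (fejer_analytic n (cis t))\<bar> \<le> pi * cmod (fejer_analytic n (cis t))"
      by (intro mult_mono abs_Im_le_cmod) auto
    then show "(pi - t) * Im (fejer_analytic n (cis t)) \<le> pi * cmod (fejer_analytic n (cis t))"
      by (metis abs_le_D1 abs_mult)
  qed
  finally show ?thesis
    by simp
qed

text \<open>The inner double sum is \<open>n + 1\<close> times the Fejer kernel at a rotated point.
  As the differences \<open>r - s\<close> are at most \<open>n\<close> in modulus, only the
  \<open>n + 1\<close> diagonal terms survive the sum over rotations.\<close>

lemma fejer_mean:
  fixes x :: complex
  assumes "cmod x = 1"
  shows "(\<Sum>l<2*n+1. \<Sum>r\<le>n. \<Sum>s\<le>n.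
      (cis (2 * pi * real l / real (2*n+1)) * x) ^ r * cnj (cis (2 * pi * real l / real (2*n+1)) * x) ^ s)
    = of_nat ((2*n+1) * (n+1))"
proof -
  define L where "L = 2*n+1"
  define \<omega> where "\<omega> l = cis (2 * pi * real l / real L)" for l
  have \<omega>: "\<omega> l ^ r * cnj (\<omega> l) ^ s = cis (2 * pi * real l * of_int (int r - int s) / real L)" for l r s
    by (simp add: \<omega>_def Complex.DeMoivre cis_cnj cis_mult algebra_simps diff_divide_distrib add_divide_distrib)
  have "(\<Sum>l<L. \<Sum>r\<le>n. \<Sum>s\<le>n. (\<omega> l * x) ^ r * cnj (\<omega> l * x) ^ s)
      = (\<Sum>r\<le>n. \<Sum>s\<le>n. x ^ r * cnj x ^ s * (\<Sum>l<L. \<omega> l ^ r * cnj (\<omega> l) ^ s))"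
    by (subst sum.swap, rule sum.cong[OF refl], subst sum.swap)
      (simp add: power_mult_distrib sum_distrib_left mult_ac)
  also have "\<dots> = (\<Sum>r\<le>n. \<Sum>s\<le>n. if s = r then of_nat L else 0)"
  proof (intro sum.cong refl)
    fix r s assume "r \<in> {..n}" "s \<in> {..n}"
    then have "(\<Sum>l<L. \<omega> l ^ r * cnj (\<omega> l) ^ s) = (if int r - int s = 0 then of_nat L else 0)"
      unfolding \<omega> by (intro sum_cis_roots_of_unity) (auto simp: L_def)
    moreover have "x ^ r * cnj x ^ r = 1"
      using assms by (simp add: power_mult_distrib[symmetric] complex_norm_square[symmetric])
    ultimately show "x ^ r * cnj x ^ s * (\<Sum>l<L. \<omega> l ^ r * cnj (\<omega> l) ^ s)
        = (if s = r then of_nat L else 0)"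
      by auto
  qed
  also have "\<dots> = of_nat (L * (n+1))"
    by (simp add: algebra_simps)
  finally show ?thesis
    by (simp add: L_def \<omega>_def)
qed

section \<open>Averaging the interpolation operator\<close>

text \<open>The averaging argument for one fixed \<open>n\<close>. With \<open>K\<close> of order
  \<open>1 / n\<close>, the resulting bound does not depend on \<open>n\<close>.\<close>

lemma fejer_analytic_L1_upper:
  fixes x :: "nat \<Rightarrow> complex"
  assumes x: "\<And>j. j \<le> n \<Longrightarrow> cmod (x j) = 1"
    and bound: "\<And>q. degree q \<le> n \<Longrightarrow>
      integral {0..2*pi} (\<lambda>t. cmod (poly q (cis t))) \<le> K * (\<Sum>j\<le>n. cmod (poly q (x j)))"
  shows "integral {0..2*pi} (\<lambda>t. cmod (fejer_analytic n (cis t))) \<le> K * real (n + 1)"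
proof -
  \<comment> \<open>The frequencies \<open>a - b - c\<close> met below lie between
    \<open>-2n\<close> and \<open>n\<close>, so \<open>2n + 1\<close> rotations separate them from
    zero.\<close>
  define L where "L = 2*n+1"
  define s where "s l = 2 * pi * real l / real L" for l
  define \<omega> where "\<omega> l = cis (s l)" for l
  have \<omega>: "\<omega> l ^ a * cnj (\<omega> l) ^ b * cnj (\<omega> l) ^ c
      = cis (2 * pi * real l * of_int (int a - int b - int c) / real L)" for l a b c
    by (simp add: \<omega>_def s_def Complex.DeMoivre cis_cnj cis_mult algebra_simps diff_divide_distrib add_divide_distrib)
  have inj: "inj_on x {..n}"
    by (rule inj_on_nodes[OF bound])
  have "\<exists>p. degree p \<le> n \<and> (\<forall>j\<le>n. poly p (x j) = x j ^ a * cnj (x j) ^ b)" for a b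
    by (rule poly_interpolation[OF _ inj, of "\<lambda>j. x j ^ a * cnj (x j) ^ b"]) auto
  then obtain p where deg_p: "degree (p a b) \<le> n"
    and p: "j \<le> n \<Longrightarrow> poly (p a b) (x j) = x j ^ a * cnj (x j) ^ b" for a b j
    by metis
  \<comment> \<open>On the circle the data are \<open>x j ^ (a - b)\<close>, so for frequencies from
    \<open>0\<close> to \<open>n\<close> the interpolant is the monomial itself. For
    \<open>a < b\<close> it depends on the nodes, but the averaging will remove it.\<close>
  have p_monom: "p a b = monom 1 (a - b)" if "b \<le> a" "a \<le> n" for a b
  proof (rule poly_eq_if_eq_at_nodes[OF inj])
    show "degree (monom 1 (a - b) :: complex poly) < card {..n}"
      using that by (simp add: degree_monom_eq)
    fix j assume j: "j \<in> {..n}"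
    have "x j ^ a * cnj (x j) ^ b = x j ^ (a - b) * (x j * cnj (x j)) ^ b"
      using that by (simp add: power_mult_distrib power_add[symmetric] mult.assoc[symmetric])
    also have "\<dots> = x j ^ (a - b)"
      using x j by (simp add: complex_norm_square[symmetric])
    finally show "poly (p a b) (x j) = poly (monom 1 (a - b)) (x j)"
      using p j by (simp add: poly_monom)
  qed (use deg_p in \<open>simp add: le_imp_less_Suc\<close>)
  \<comment> \<open>\<open>q l\<close> interpolates \<open>n + 1\<close> times the Fejer kernel
    rotated by \<open>\<omega> l\<close>.\<close>
  define q where "q l = (\<Sum>a\<le>n. \<Sum>b\<le>n. smult (\<omega> l ^ a * cnj (\<omega> l) ^ b) (p a b))" for l
  have deg_q: "degree (q l) \<le> n" for l
    unfolding q_def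
    by (intro degree_sum_le order_trans[OF degree_smult_le] deg_p) auto
  have q_nodes: "poly (q l) (x j) = (\<Sum>a\<le>n. \<Sum>b\<le>n. (\<omega> l * x j) ^ a * cnj (\<omega> l * x j) ^ b)"
    if "j \<le> n" for l j
    using that by (simp add: q_def poly_sum p power_mult_distrib mult_ac)
  \<comment> \<open>The data are squared moduli, hence equal to their own absolute values; their
    \<open>\<ell>\<close>1 norm can thus be computed by \<open>fejer_mean\<close>.\<close>
  have q_nodes_norm: "of_real (cmod (poly (q l) (x j)))
      = (\<Sum>a\<le>n. \<Sum>b\<le>n. (\<omega> l * x j) ^ a * cnj (\<omega> l * x j) ^ b)" if "j \<le> n" for l j
  proof -
    have "poly (q l) (x j) = (\<Sum>a\<le>n. (\<omega> l * x j) ^ a) * cnj (\<Sum>a\<le>n. (\<omega> l * x j) ^ a)"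
      using that by (simp add: q_nodes sum_product)
    then have "poly (q l) (x j) = of_real ((cmod (\<Sum>a\<le>n. (\<omega> l * x j) ^ a))\<^sup>2)"
      by (simp only: complex_norm_square)
    then have "of_real (cmod (poly (q l) (x j))) = poly (q l) (x j)"
      by (simp add: norm_power)
    then show ?thesis
      using q_nodes that by simp
  qed
  have data: "(\<Sum>l<L. cmod (poly (q l) (x j))) = real (L * (n + 1))" if "j \<le> n" for j
  proof -
    have "of_real (\<Sum>l<L. cmod (poly (q l) (x j))) = (of_nat (L * (n + 1)) :: complex)"
      using fejer_mean[OF x[OF that], of n] that
      by (simp only: of_real_sum q_nodes_norm \<omega>_def s_def L_def)
    then show ?thesis
      by (metis of_real_eq_iff of_real_of_nat_eq)
  qed
  \<comment> \<open>After rotating back, the coefficient of degree \<open>c\<close> in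
    \<open>p a b\<close> carries the factor \<open>\<omega> l\<close> to the power
    \<open>a - b - c\<close>, so the sum over \<open>l\<close> keeps only
    \<open>c = a - b\<close>.\<close>
  have average: "(\<Sum>l<L. poly (q l) (cnj (\<omega> l) * w)) = of_nat (L * (n + 1)) * fejer_analytic n w" for w
  proof -
    have poly_p: "poly (p a b) v = (\<Sum>c\<le>n. coeff (p a b) c * v ^ c)" for a b v
      unfolding poly_altdef using deg_p[of a b]
      by (intro sum.mono_neutral_left) (auto simp: coeff_eq_0)
    have rotated: "(\<Sum>l<L. \<omega> l ^ a * cnj (\<omega> l) ^ b * poly (p a b) (cnj (\<omega> l) * w))
        = (if b \<le> a then of_nat L * w ^ (a - b) else 0)" if ab: "a \<le> n" "b \<le> n" for a b
    proof -
      have "(\<Sum>l<L. \<omega> l ^ a * cnj (\<omega> l) ^ b * poly (p a b) (cnj (\<omega> l) * w))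
          = (\<Sum>l<L. \<Sum>c\<le>n. coeff (p a b) c * w ^ c * (\<omega> l ^ a * cnj (\<omega> l) ^ b * cnj (\<omega> l) ^ c))"
        by (simp add: poly_p sum_distrib_left power_mult_distrib mult_ac)
      also have "\<dots> = (\<Sum>c\<le>n. coeff (p a b) c * w ^ c
          * (\<Sum>l<L. \<omega> l ^ a * cnj (\<omega> l) ^ b * cnj (\<omega> l) ^ c))"
        by (subst sum.swap) (simp add: sum_distrib_left)
      also have "\<dots> = (\<Sum>c\<le>n. coeff (p a b) c * w ^ c
          * (if int a - int b - int c = 0 then of_nat L else 0))"
        unfolding \<omega>
        by (intro sum.cong refl arg_cong2[where f = "(*)"] sum_cis_roots_of_unity)
          (use ab in \<open>auto simp: L_def\<close>)
      \<comment> \<open>Subtraction is now truncated, so the inner test \<open>b \<le> a\<close> is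
        what discards the negative frequencies.\<close>
      also have "\<dots> = (\<Sum>c\<le>n. if c = a - b then
          (if b \<le> a then of_nat L * (coeff (p a b) c * w ^ c) else 0) else 0)"
        by (intro sum.cong) auto
      also have "\<dots> = (if b \<le> a then of_nat L * w ^ (a - b) else 0)"
        using ab p_monom[of b a] by (simp add: le_diff_conv)
      finally show ?thesis .
    qed
    have "(\<Sum>l<L. poly (q l) (cnj (\<omega> l) * w))
        = (\<Sum>a\<le>n. \<Sum>b\<le>n. \<Sum>l<L. \<omega> l ^ a * cnj (\<omega> l) ^ b * poly (p a b) (cnj (\<omega> l) * w))"
      by (simp add: q_def poly_sum, subst sum.swap, rule sum.cong[OF refl], subst sum.swap) simp
    also have "\<dots> = (\<Sum>a\<le>n. \<Sum>b\<le>n. of_nat L * (if b \<le> a then w ^ (a - b) else 0))"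
      by (intro sum.cong refl) (simp add: rotated)
    also have "\<dots> = of_nat L * (of_nat (n + 1) * fejer_analytic n w)"
      by (simp only: fejer_analytic_double_sum sum_distrib_left)
    finally show ?thesis
      by (simp only: of_nat_mult mult.assoc)
  qed
  have L: "L > 0"
    by (simp add: L_def)
  have s: "0 \<le> s l" "s l \<le> 2 * pi" if "l < L" for l
    using that by (auto simp: s_def field_simps)
  \<comment> \<open>Triangle inequality, rotation invariance of the integral, the assumed bound for
    each \<open>q l\<close>, and finally \<open>data\<close>.\<close>
  have "real (L * (n + 1)) * integral {0..2*pi} (\<lambda>t. cmod (fejer_analytic n (cis t)))
      = integral {0..2*pi} (\<lambda>t. cmod (\<Sum>l<L. poly (q l) (cnj (\<omega> l) * cis t)))"
    by (simp only: average norm_mult norm_of_nat integral_mult_right)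
  also have "\<dots> \<le> integral {0..2*pi} (\<lambda>t. \<Sum>l<L. cmod (poly (q l) (cnj (\<omega> l) * cis t)))"
    by (intro integral_le integrable_continuous_real continuous_intros norm_sum)
  also have "\<dots> = (\<Sum>l<L. integral {0..2*pi} (\<lambda>t. cmod (poly (q l) (cnj (\<omega> l) * cis t))))"
    by (intro integral_sum integrable_continuous_real continuous_intros) auto
  also have "\<dots> = (\<Sum>l<L. integral {0..2*pi} (\<lambda>t. cmod (poly (q l) (cis t))))"
    unfolding \<omega>_def
    by (intro sum.cong refl integral_rotate_cis[of "\<lambda>w. cmod (poly (q _) w)"] continuous_intros s) auto
  also have "\<dots> \<le> (\<Sum>l<L. K * (\<Sum>j\<le>n. cmod (poly (q l) (x j))))"
    by (intro sum_mono bound deg_q)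
  also have "\<dots> = K * (\<Sum>j\<le>n. \<Sum>l<L. cmod (poly (q l) (x j)))"
    by (subst sum.swap) (simp add: sum_distrib_left)
  also have "\<dots> = K * (real (n + 1) * real (L * (n + 1)))"
    by (simp add: data)
  finally have "real (L * (n + 1)) * integral {0..2*pi} (\<lambda>t. cmod (fejer_analytic n (cis t)))
      \<le> real (L * (n + 1)) * (K * real (n + 1))"
    by (simp only: mult_ac)
  then show ?thesis
    using L by (subst (asm) mult_le_cancel_left_pos) (simp_all del: of_nat_mult)
qed

theorem theorem2:
  shows "\<not> (\<exists>m z. triangular_family m z \<and> (\<forall>n. m n = n) \<and> MZ_family_L1 m z)"
proof
  assume "\<exists>m z. triangular_family m z \<and> (\<forall>n. m n = n) \<and> MZ_family_L1 m z"
  then obtain m z where m: "m n = n" and z: "triangular_family m z" and MZ: "MZ_family_L1 m z" for n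
    by blast
  obtain C where C: "C > 0" and upper: "\<And>n q. n \<ge> 1 \<Longrightarrow> degree q \<le> n \<Longrightarrow>
      integral {0..2*pi} (\<lambda>t. cmod (poly q (cis t))) \<le> C / real n * (\<Sum>j\<le>n. cmod (poly q (z n j)))"
    using MZ by (auto simp: MZ_family_L1_def polys_upto_def m atLeast0AtMost)
  have "harm n \<le> C + 1" if n: "n \<ge> 1" for n
  proof -
    have "2 * (harm n - 1) \<le> integral {0..2*pi} (\<lambda>t. cmod (fejer_analytic n (cis t)))"
      by (rule fejer_analytic_L1_lower)
    also have "\<dots> \<le> C / real n * real (n + 1)"
      by (rule fejer_analytic_L1_upper[of n "z n"])
        (use z upper n in \<open>auto simp: triangular_family_def m\<close>)
    \<comment> \<open>Here \<open>(n + 1) / n \<le> 2\<close>, since \<open>n \<ge> 1\<close>. The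
      harmonic numbers would therefore be bounded.\<close>
    also have "\<dots> \<le> 2 * C"
      using C n by (simp add: field_simps)
    finally show ?thesis by simp
  qed
  moreover have "\<forall>\<^sub>F n in at_top. (harm n :: real) > C + 1"
    using harm_at_top by (rule filterlim_at_top_dense[THEN iffD1, rule_format])
  ultimately show False
    using eventually_happens[OF eventually_conj[OF _ eventually_ge_at_top[of 1]]]
    by (metis linorder_not_le sequentially_bot)
qed

end
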